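(* Let $m\ge 1$ be an integer and let $a,b$ be the following permutations (cycles) of $\{1,2,\ldots,3m+1\}$: $$a=(1,2,\ldots,2m+1),\qquad b=(m+1,m,\ldots,1,2m+2,2m+3,\ldots,3m+1).$$ Let $c=ab$ and let $\alpha=a$, $\beta=b$, $\gamma=c^{-1}$, elements of $G=A_{3m+1}$, the alternating group on $3m+1$ letters. Then $\alpha\beta\gamma=1$; the subgroups $\langle\alpha\rangle,\langle\beta\rangle,\langle\gamma\rangle$ pairwise intersect trivially; and $\langle\alpha,\beta,\gamma\rangle=G$. Thus for each $m\ge 1$ there exists a primary $(2m+1)$-homogeneous latin bitrade of size $(3m+1)!/2$, given by $$\bigl(\{(g\langle\alpha\rangle,g\langle\beta\rangle,g\langle\gamma\rangle)\mid g\in G\},\ \{(g\langle\alpha\rangle,g\langle\beta\rangle,g\alpha^{-1}\langle\gamma\rangle)\mid g\in G\}\bigr).$$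
   Context: Permutations are composed from left to right: $x(ab)=(xa)b$. Let $A_1,A_2,A_3$ be finite, non-empty, pairwise disjoint sets (of rows, columns and symbols/entries, respectively). A partial latin square is a subset $T\subseteq A_1\times A_2\times A_3$ such that (P1) if $(a_1,a_2,a_3),(b_1,b_2,b_3)\in T$ then either at most one of $a_1=b_1$, $a_2=b_2$, $a_3=b_3$ is true or all three are true; (P2) every element of $A_1\cup A_2\cup A_3$ occurs as a coordinate of some element of $T$. A latin bitrade is a pair $(T^{\circ},T^{\star})$ of partial latin squares $T^{\circ},T^{\star}\subset A_1\times A_2\times A_3$ such that (R1) $T^{\circ}\cap T^{\star}=\emptyset$; (R2) for all $(a_1,a_2,a_3)\in T^{\circ}$ and all $r\ne s$ in $\{1,2,3\}$ there is a unique $(b_1,b_2,b_3)\in T^{\star}$ with $a_r=b_r$ and $a_s=b_s$; (R3) the same as (R2) with $T^{\circ}$ and $T^{\star}$ interchanged. Its size is $|T^{\circ}|=|T^{\star}|$. In the claim, $A_1,A_2,A_3$ are the sets of left cosets in $G$ of $\langle\alpha\rangle,\langle\beta\rangle,\langle\gamma\rangle$. A latin bitrade $(T^{\circ},T^{\star})$ is primary if whenever $(U^{\circ},U^{\star})$ is a latin bitrade (with respect to some sets of rows, columns and symbols) with $U^{\circ}\subseteq T^{\circ}$ and $U^{\star}\subseteq T^{\star}$, then $(U^{\circ},U^{\star})=(T^{\circ},T^{\star})$. It is $k$-homogeneous if each row and each column of $T^{\circ}$ contains precisely $k$ entries and each symbol occurs precisely $k$ times within $T^{\circ}$. *)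

theory Defs
  imports "HOL-Algebra.Algebra" "HOL-Combinatorics.Cycles"
begin

text \<open>
  The alternating group on the letters 1, ..., n, with permutations composed from left to right:
  the library's \<^const>\<open>alt_group\<close> multiplies by function composition, i.e. from right to left, so
  the factors are swapped here.
\<close>

definition alt_group_lr :: "nat \<Rightarrow> (nat \<Rightarrow> nat) monoid" where
  "alt_group_lr n = (alt_group n) \<lparr> mult := (\<lambda>p q. q \<circ> p) \<rparr>"

text \<open>
  Rows, columns and symbols live in one common type, so that their disjointness is a genuine
  condition and coordinates can be addressed by an index in {1, 2, 3}.
\<close>

definition coord :: "nat \<Rightarrow> 'a \<times> 'a \<times> 'a \<Rightarrow> 'a" where
  "coord r t = (if r = 1 then fst t else if r = 2 then fst (snd t) else snd (snd t))"

definition partial_latin_square ::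
  "'a set \<Rightarrow> 'a set \<Rightarrow> 'a set \<Rightarrow> ('a \<times> 'a \<times> 'a) set \<Rightarrow> bool" where
  "partial_latin_square A1 A2 A3 T \<longleftrightarrow>
     (finite A1 \<and> finite A2 \<and> finite A3) \<and>
     (A1 \<noteq> {} \<and> A2 \<noteq> {} \<and> A3 \<noteq> {}) \<and>
     (A1 \<inter> A2 = {} \<and> A1 \<inter> A3 = {} \<and> A2 \<inter> A3 = {}) \<and>
     T \<subseteq> A1 \<times> A2 \<times> A3 \<and>
     (\<forall>t\<in>T. \<forall>u\<in>T. card {r \<in> {1, 2, 3}. coord r t = coord r u} \<le> 1 \<or>
                  (\<forall>r\<in>{1, 2, 3}. coord r t = coord r u)) \<and>
     (\<forall>x \<in> A1 \<union> A2 \<union> A3. \<exists>t\<in>T. \<exists>r\<in>{1, 2, 3}. coord r t = x)"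

definition latin_bitrade ::
  "'a set \<Rightarrow> 'a set \<Rightarrow> 'a set \<Rightarrow> ('a \<times> 'a \<times> 'a) set \<Rightarrow> ('a \<times> 'a \<times> 'a) set \<Rightarrow> bool" where
  "latin_bitrade A1 A2 A3 T T' \<longleftrightarrow>
     partial_latin_square A1 A2 A3 T \<and> partial_latin_square A1 A2 A3 T' \<and>
     T \<inter> T' = {} \<and>
     (\<forall>t\<in>T. \<forall>r\<in>{1, 2, 3}. \<forall>s\<in>{1, 2, 3}. r \<noteq> s \<longrightarrow>
        (\<exists>!u. u \<in> T' \<and> coord r t = coord r u \<and> coord s t = coord s u)) \<and>
     (\<forall>t\<in>T'. \<forall>r\<in>{1, 2, 3}. \<forall>s\<in>{1, 2, 3}. r \<noteq> s \<longrightarrow>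
        (\<exists>!u. u \<in> T \<and> coord r t = coord r u \<and> coord s t = coord s u))"

definition primary_bitrade ::
  "'a set \<Rightarrow> 'a set \<Rightarrow> 'a set \<Rightarrow> ('a \<times> 'a \<times> 'a) set \<Rightarrow> ('a \<times> 'a \<times> 'a) set \<Rightarrow> bool" where
  "primary_bitrade A1 A2 A3 T T' \<longleftrightarrow>
     latin_bitrade A1 A2 A3 T T' \<and>
     (\<forall>B1 B2 B3 U U'. latin_bitrade B1 B2 B3 U U' \<and> U \<subseteq> T \<and> U' \<subseteq> T' \<longrightarrow> U = T \<and> U' = T')"

definition homogeneous_bitrade ::
  "nat \<Rightarrow> 'a set \<Rightarrow> 'a set \<Rightarrow> 'a set \<Rightarrow> ('a \<times> 'a \<times> 'a) set \<Rightarrow> ('a \<times> 'a \<times> 'a) set \<Rightarrow> bool" where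
  "homogeneous_bitrade k A1 A2 A3 T T' \<longleftrightarrow>
     latin_bitrade A1 A2 A3 T T' \<and>
     (\<forall>x\<in>A1. card {t \<in> T. coord 1 t = x} = k) \<and>
     (\<forall>x\<in>A2. card {t \<in> T. coord 2 t = x} = k) \<and>
     (\<forall>x\<in>A3. card {t \<in> T. coord 3 t = x} = k)"

end

theory Submission
  imports Defs
begin

text \<open>
  Generation: the product \<open>ab\<close> is the cycle \<open>c = (m+1, \<dots>, 3m+1)\<close>, and a commutator of \<open>a\<close> and \<open>c\<close>
  is the double transposition \<open>(1 2m+1)(m+1 3m+1)\<close>. For \<open>m \<ge> 2\<close> two of its conjugates have only the
  point 1 in common, so the square of their product is a 3-cycle moving 1 and 2. Conjugating with
  \<open>a\<close> and \<open>c\<close> puts every pair \<open>i, i+1\<close> into some 3-cycle of the group, and from this all 3-cycles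
  follow.

  Trivial intersections: a power of a cycle that fixes one point of the cycle is the identity, and
  each of the three cycles moves a point fixed by another one.

  The bitrade: two coordinates of \<open>(gA, gB, gC)\<close> determine \<open>g\<close>, and
  \<open>g \<alpha>\<^sup>-\<^sup>1 C = g \<beta> C\<close>, so that the triple of \<open>T'\<close> at \<open>g\<close> shares two of its coordinates with the
  triples of \<open>T\<close> at \<open>g\<close>, \<open>g \<alpha>\<^sup>-\<^sup>1\<close> and \<open>g \<beta>\<close> respectively. Hence the triples of a smaller bitrade come
  from a set closed under right multiplication with the generators, which is all of \<open>G\<close>.
\<close>

section \<open>Permutation groups containing 3-cycles\<close>

text \<open>Closure under composition does not see the order of the factors, so the locale also fits
  groups multiplied from left to right.\<close>

locale perm_group =
  fixes H :: "('a \<Rightarrow> 'a) set"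
  assumes id_closed: "id \<in> H"
    and bij: "p \<in> H \<Longrightarrow> bij p"
    and comp_closed: "p \<in> H \<Longrightarrow> q \<in> H \<Longrightarrow> p \<circ> q \<in> H"
    and inv_closed: "p \<in> H \<Longrightarrow> inv' p \<in> H"
begin

lemma conj_cycle:
  assumes "g \<in> H" and "cycle cs" and "cycle_of_list cs \<in> H"
  shows "cycle_of_list (map g cs) \<in> H"
  using assms bij comp_closed inv_closed by (metis conjugation_of_cycle)

text \<open>Conjugation by \<open>g\<close> relabels the points. This moves one double transposition
  of the group to others.\<close>

lemma conj_transpose_pair:
  assumes g: "g \<in> H" and t: "transpose p q \<circ> transpose r s \<in> H"
  shows "transpose (g p) (g q) \<circ> transpose (g r) (g s) \<in> H"
proof -
  have "g \<circ> (transpose p q \<circ> transpose r s) = transpose (g p) (g q) \<circ> transpose (g r) (g s) \<circ> g"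
    using bij[OF g] by (auto simp: fun_eq_iff transpose_def bij_is_inj inj_eq)
  then have "g \<circ> (transpose p q \<circ> transpose r s) \<circ> inv' g = transpose (g p) (g q) \<circ> transpose (g r) (g s)"
    using bij[OF g] by (simp add: comp_assoc bij_is_surj surj_iff[THEN iffD1])
  moreover have "g \<circ> (transpose p q \<circ> transpose r s) \<circ> inv' g \<in> H"
    by (intro comp_closed[OF comp_closed] g t inv_closed)
  ultimately show ?thesis by (simp only:)
qed

text \<open>Distinctness of the points is built in, so that the rules below carry it along.\<close>

definition three_cycle :: "'a \<Rightarrow> 'a \<Rightarrow> 'a \<Rightarrow> bool" where
  "three_cycle x y z \<longleftrightarrow> cycle [x, y, z] \<and> cycle_of_list [x, y, z] \<in> H"

lemma three_cycle_rotate: "three_cycle x y z \<Longrightarrow> three_cycle y z x"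
  using cycle_of_list_rotate_independent[of "[x, y, z]" 1] by (auto simp: three_cycle_def)

text \<open>\<open>[y, x, z]\<close> gives the inverse 3-cycle. Together with rotation this makes
  \<open>three_cycle\<close> symmetric in its three points.\<close>

lemma three_cycle_swap:
  assumes "three_cycle x y z"
  shows "three_cycle y x z"
proof -
  have "cycle_of_list [y, x, z] = inv' (cycle_of_list [x, y, z])"
    using assms unfolding three_cycle_def
    by (intro inv_unique_comp[symmetric]) (auto simp: fun_eq_iff transpose_def)
  then show ?thesis using assms inv_closed by (auto simp: three_cycle_def)
qed

lemma three_cycle_conj:
  assumes "g \<in> H" and "three_cycle x y z"
  shows "three_cycle (g x) (g y) (g z)"
  using assms conj_cycle[of g "[x, y, z]"] bij[of g]
  by (auto simp: three_cycle_def inj_eq bij_is_inj)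

lemma three_cycle_swap_last: "three_cycle x y z \<Longrightarrow> three_cycle x z y"
  by (rule three_cycle_rotate[OF three_cycle_swap])

text \<open>Conjugation by the 3-cycle u -> y -> x -> u turns the pair \<open>y, u\<close> into
  \<open>x, y\<close> and fixes \<open>z\<close>.\<close>

lemma three_cycle_common_pair:
  assumes "three_cycle y u x" and "three_cycle y u z" and "x \<noteq> z"
  shows "three_cycle y x z"
proof -
  let ?g = "cycle_of_list [u, y, x]"
  have "three_cycle u y x" using assms(1) by (rule three_cycle_swap)
  then have g: "?g \<in> H" "cycle [u, y, x]" by (auto simp: three_cycle_def)
  have "z \<noteq> u" "z \<noteq> y" using assms(2) by (auto simp: three_cycle_def)
  then have "?g y = x" "?g u = y" "?g z = z" using g(2) assms(3) by auto
  then have "three_cycle x y z" using three_cycle_conj[OF g(1) assms(2)] by (simp only:)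
  then show ?thesis by (rule three_cycle_swap)
qed

text \<open>In general position, conjugating the second 3-cycle by the first replaces
  \<open>y\<close> by \<open>x\<close>; the result shares the pair \<open>z, v\<close> with the
  original, and \<open>three_cycle_common_pair\<close> applies. If points coincide, a rearrangement
  or that lemma suffices at once.\<close>

lemma three_cycle_common_point:
  assumes "three_cycle y x u" and "three_cycle y z v" and "x \<noteq> z"
  shows "three_cycle y x z"
proof -
  consider "u = z" | "v = x" | "u = v" | "u \<noteq> z" "v \<noteq> x" "u \<noteq> v" by blast
  then show ?thesis
  proof cases
    case 1
    then show ?thesis using assms by simp
  next
    case 2
    then show ?thesis using three_cycle_swap_last[OF assms(2)] by simp
  next
    case 3
    then show ?thesis
      using three_cycle_common_pair[OF three_cycle_swap_last[OF assms(1)]]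
        three_cycle_swap_last[OF assms(2)] assms(3) by simp
  next
    case 4
    let ?g = "cycle_of_list [y, x, u]"
    have neq: "?g \<in> H" "cycle [y, x, u]" "cycle [y, z, v]" using assms by (auto simp: three_cycle_def)
    have "?g y = x" "?g z = z" "?g v = v"
      using neq 4 assms(3) by auto
    then have xzv: "three_cycle x z v" using three_cycle_conj[OF neq(1) assms(2)] by (simp only:)
    have "three_cycle z x y"
      using three_cycle_common_pair[OF three_cycle_rotate[OF xzv] three_cycle_rotate[OF assms(2)]] neq(2)
      by auto
    then show ?thesis by (rule three_cycle_swap[OF three_cycle_rotate])
  qed
qed

text \<open>The product is the 3-cycle p -> u -> q -> p times the transpositions of
  \<open>r, s\<close> and of \<open>v, w\<close>; squaring removes these and leaves p -> q -> u ->
  p.\<close>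

lemma three_cycle_of_transposition_pairs:
  assumes "transpose p q \<circ> transpose r s \<in> H" and "transpose p u \<circ> transpose v w \<in> H"
    and "distinct [p, q, r, s, u, v, w]"
  shows "three_cycle p q u"
proof -
  let ?f = "(transpose p q \<circ> transpose r s) \<circ> (transpose p u \<circ> transpose v w)"
  have "?f \<circ> ?f = cycle_of_list [p, q, u]"
  proof
    fix x
    have "?f p = u" "?f u = q" "?f q = p" "?f r = s" "?f s = r" "?f v = w" "?f w = v"
      using assms(3) by auto
    moreover have "?f x = x" if "x \<notin> {p, q, r, s, u, v, w}" using that by auto
    ultimately have "(?f \<circ> ?f) x = (if x = p then q else if x = q then u else if x = u then p else x)"
      by (cases "x \<in> {p, q, r, s, u, v, w}") (auto simp del: comp_apply simp: comp_def)
    moreover have "cycle_of_list [p, q, u] x = (if x = p then q else if x = q then u else if x = u then p else x)"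
      using assms(3) by (auto simp: transpose_def)
    ultimately show "(?f \<circ> ?f) x = cycle_of_list [p, q, u] x" by simp
  qed
  moreover have "?f \<circ> ?f \<in> H" using assms comp_closed by blast
  ultimately show ?thesis using assms(3) by (auto simp: three_cycle_def)
qed

end


text \<open>\<open>three_cycle_common_point\<close> chains consecutive pairs to all pairs of
  letters; applied to the pairs \<open>y, x\<close> and \<open>y, z\<close> it then gives a 3-cycle
  on any three letters. The 3-cycles generate the alternating group.\<close>

lemma alt_group_subset_if_consecutive_three_cycles:
  assumes "perm_group H"
    and step: "\<And>i. 1 \<le> i \<Longrightarrow> i < n \<Longrightarrow> \<exists>u. perm_group.three_cycle H i (Suc i) u"
  shows "carrier (alt_group n) \<subseteq> H"
proof -
  interpret perm_group H by fact
  have less: "\<exists>u. three_cycle i j u" if "1 \<le> i" "i < j" "j \<le> n" for i j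
    using that(2,1,3)
  proof (induction j)
    case 0
    then show ?case by simp
  next
    case (Suc j)
    obtain v where v: "three_cycle j (Suc j) v" using Suc.prems step[of j] by auto
    show ?case
    proof (cases "i = j")
      case True
      then show ?thesis using v by blast
    next
      case False
      then have "\<exists>u. three_cycle i j u" using Suc by simp
      then obtain u where "three_cycle i j u" by blast
      from three_cycle_common_point[OF three_cycle_swap[OF this] v] Suc.prems
      have "three_cycle j i (Suc j)" by simp
      then show ?thesis using three_cycle_swap_last[OF three_cycle_swap] by blast
    qed
  qed
  have pair: "\<exists>u. three_cycle i j u" if "i \<in> {1..n}" "j \<in> {1..n}" "i \<noteq> j" for i j
  proof (cases "i < j")
    case True
    then show ?thesis using that less by simp
  next
    case False
    then have "\<exists>u. three_cycle j i u" using that less by simp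
    then show ?thesis using three_cycle_swap by blast
  qed
  have incl: "three_cycles n \<subseteq> H"
  proof clarify
    fix cs :: "nat list" assume cs: "cycle cs" "length cs = 3" "set cs \<subseteq> {1..n}"
    then obtain x y z where xyz: "cs = [x, y, z]" using stupid_lemma[OF cs(2)] by blast
    obtain u v where "three_cycle y x u" "three_cycle y z v"
      using cs xyz pair[of y x] pair[of y z] by auto
    from three_cycle_common_point[OF this] cs xyz have "three_cycle y x z" by simp
    then have "three_cycle x y z" by (rule three_cycle_swap)
    then show "cycle_of_list cs \<in> H" by (simp add: three_cycle_def xyz)
  qed
  have "p \<in> H" if "p \<in> generate (alt_group n) (three_cycles n)" for p
    using that
  proof (induction p rule: generate.induct)
    case one
    then show ?case using id_closed by (simp only: alt_group_one)
  next
    case (incl p)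
    then show ?case using \<open>three_cycles n \<subseteq> H\<close> by blast
  next
    case (inv p)
    then have "p \<in> carrier (alt_group n)" "p \<in> H" using three_cycles_incl incl by blast+
    then show ?case using inv_closed alt_group_inv_equality by metis
  next
    case (eng p q)
    then show ?case using comp_closed by (simp only: alt_group_mult)
  qed
  then show ?thesis unfolding alt_group_carrier_as_three_cycles by blast
qed

section \<open>Cycles\<close>

lemma cycle_of_list_nth:
  assumes "cycle cs" and "i < length cs"
  shows "(cycle_of_list cs ^^ k) (cs ! i) = cs ! ((k + i) mod length cs)"
proof -
  have "map (cycle_of_list cs ^^ k) cs ! i = rotate k cs ! i"
    using cyclic_rotation[OF assms(1)] by simp
  then show ?thesis using assms(2) by (simp add: nth_rotate)
qed

lemma cycle_of_list_nth_Suc: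
  assumes "cycle cs" and "Suc i < length cs"
  shows "cycle_of_list cs (cs ! i) = cs ! Suc i"
  using cycle_of_list_nth[of cs i 1] assms by simp

lemma cycle_of_list_last:
  assumes "cycle cs" and "cs \<noteq> []"
  shows "cycle_of_list cs (last cs) = hd cs"
  using cycle_of_list_nth[of cs "length cs - 1" 1] assms by (simp add: last_conv_nth hd_conv_nth)

text \<open>The k-th power shifts all positions of the list by k modulo its length, so fixing a
  single listed point already forces the length to divide k.\<close>

lemma cycle_power_eq_id_iff:
  assumes "cycle cs" and "x \<in> set cs"
  shows "(cycle_of_list cs ^^ k) x = x \<longleftrightarrow> length cs dvd k"
    and "cycle_of_list cs ^^ k = id \<longleftrightarrow> length cs dvd k"
proof -
  obtain i where i: "i < length cs" "x = cs ! i" using assms(2) by (metis in_set_conv_nth)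
  have "(k + i) mod length cs < length cs" using i(1) by (intro mod_less_divisor) linarith
  then have "(cycle_of_list cs ^^ k) x = x \<longleftrightarrow> (k + i) mod length cs = i mod length cs"
    using cycle_of_list_nth[OF assms(1) i(1)] i assms(1) by (simp add: nth_eq_iff_index_eq)
  also have "\<dots> \<longleftrightarrow> length cs dvd k"
    using mod_eq_dvd_iff_nat[of i "k + i" "length cs"] by simp
  finally show 1: "(cycle_of_list cs ^^ k) x = x \<longleftrightarrow> length cs dvd k" .
  have "cycle_of_list cs ^^ k = id" if "length cs dvd k"
    using that cycle_is_id_root[OF assms(1)] by (metis dvdE funpow_mult id_funpow)
  then show "cycle_of_list cs ^^ k = id \<longleftrightarrow> length cs dvd k"
    using 1 by auto
qed

text \<open>The power with exponent \<open>length cs\<close> is the identity, so an odd power of the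
  sign is 1 and the sign itself is 1.\<close>

lemma evenperm_cycle_of_list:
  assumes "cycle cs" and "odd (length cs)"
  shows "evenperm (cycle_of_list cs)"
proof -
  have "sign (cycle_of_list cs ^^ k) = sign (cycle_of_list cs) ^ k" for k
    by (induction k)
      (simp_all only: funpow.simps power.simps sign_id
        sign_compose[OF permutation_of_cycle permutation_funpow[OF permutation_of_cycle]])
  then have "sign (cycle_of_list cs) ^ length cs = 1"
    by (metis assms(1) cycle_is_id_root sign_id)
  then show ?thesis using assms(2) by (auto simp: sign_def split: if_splits)
qed

lemma cycle_of_list_upt:
  "cycle_of_list [i..<Suc j] x = (if i \<le> x \<and> x < j then Suc x else if x = j \<and> i \<le> j then i else x)"
proof (cases "x \<in> set [i..<Suc j]")
  case True
  show ?thesis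
  proof (cases "x = j")
    case True
    then show ?thesis
      using cycle_of_list_last[of "[i..<Suc j]"] \<open>x \<in> set [i..<Suc j]\<close>
      by (simp add: last_upt del: upt_Suc)
  next
    case False
    then have "[i..<Suc j] ! (x - i) = x" "[i..<Suc j] ! Suc (x - i) = Suc x"
      using \<open>x \<in> set [i..<Suc j]\<close> by (auto simp del: upt_Suc)
    then show ?thesis
      using cycle_of_list_nth_Suc[of "[i..<Suc j]" "x - i"] False \<open>x \<in> set [i..<Suc j]\<close>
      by (auto simp del: upt_Suc)
  qed
next
  case False
  then show ?thesis by (subst id_outside_supp) auto
qed

section \<open>Generation of the alternating group by the cycles \<open>a\<close> and
  \<open>c\<close>\<close>

lemma alt_group_subset_if_two_cycles:
  fixes m :: nat
  assumes "perm_group H" and m: "m \<ge> 1"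
    and a: "a = cycle_of_list [1..<2 * m + 2]" and c: "c = cycle_of_list [m + 1..<3 * m + 2]"
    and aH: "a \<in> H" and cH: "c \<in> H"
  shows "carrier (alt_group (3 * m + 1)) \<subseteq> H"
proof -
  interpret perm_group H by fact
  have a_apply: "a x = (if 1 \<le> x \<and> x < 2 * m + 1 then Suc x else if x = 2 * m + 1 then 1 else x)" for x
    using cycle_of_list_upt[of 1 "2 * m + 1" x] by (simp add: a)
  have c_apply: "c x = (if m + 1 \<le> x \<and> x < 3 * m + 1 then Suc x else if x = 3 * m + 1 then m + 1 else x)" for x
    using cycle_of_list_upt[of "m + 1" "3 * m + 1" x] by (simp add: c)
  have "\<exists>u. three_cycle 1 2 u"
  proof (cases "m = 1")
    \<comment> \<open>For m = 1 the two double transpositions of the general case coincide, but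
      \<open>a\<close> is itself a 3-cycle.\<close>
    case True
    then have "a = cycle_of_list [1, 2, 3]" by (simp add: a upt_conv_Cons numeral_2_eq_2 numeral_3_eq_3)
    then have "three_cycle 1 2 3" using aH by (simp add: three_cycle_def)
    then show ?thesis by blast
  next
    case False
    with m have m2: "m \<ge> 2" by simp
    let ?t = "transpose 1 (2 * m + 1) \<circ> transpose (m + 1) (3 * m + 1)"
    \<comment> \<open>Free of inverses, hence checkable point by point; it says that
      \<open>?t\<close> is the commutator c^-1 a c a^-1.\<close>
    have "c \<circ> ?t \<circ> a = a \<circ> c"
      using m by (auto simp: fun_eq_iff a_apply c_apply transpose_def)
    then have "inv' c \<circ> (c \<circ> ?t \<circ> a) \<circ> inv' a = inv' c \<circ> (a \<circ> c) \<circ> inv' a" by simp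
    then have "?t = inv' c \<circ> (a \<circ> c) \<circ> inv' a"
      using bij[OF aH] bij[OF cH]
      by (simp add: fun_eq_iff bij_is_inj bij_is_surj surj_f_inv_f)
    then have t: "?t \<in> H" using aH cH comp_closed inv_closed by metis
    have inv_c: "inv' c y = x" if "c x = y" for x y
      using that bij[OF cH] by (auto simp: bij_is_inj)
    have ta: "transpose 1 2 \<circ> transpose (m + 2) (3 * m + 1) \<in> H"
      using conj_transpose_pair[OF aH t] m by (simp add: a_apply transpose_commute numeral_2_eq_2)
    \<comment> \<open>The conjugate of \<open>?t\<close> by the power of \<open>c\<close> with
      exponent -(i+1): 1 is fixed and the other three points move down along \<open>c\<close>. The
      base case absorbs the wrap-around from \<open>m + 1\<close> to
      \<open>3 * m + 1\<close>.\<close>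
    have "transpose 1 (2 * m - i) \<circ> transpose (3 * m + 1 - i) (3 * m - i) \<in> H" if "i \<le> m - 1" for i
      using that
    proof (induction i)
      case 0
      have "inv' c 1 = 1" "inv' c (2 * m + 1) = 2 * m" "inv' c (m + 1) = 3 * m + 1" "inv' c (3 * m + 1) = 3 * m"
        by (rule inv_c, use m2 in \<open>simp add: c_apply\<close>)+
      then show ?case using conj_transpose_pair[OF inv_closed[OF cH] t] by (simp add: comp_def)
    next
      case (Suc i)
      have "inv' c 1 = 1" "inv' c (2 * m - i) = 2 * m - Suc i"
        "inv' c (3 * m + 1 - i) = 3 * m + 1 - Suc i" "inv' c (3 * m - i) = 3 * m - Suc i"
        by (rule inv_c, use m2 Suc.prems in \<open>auto simp: c_apply\<close>)+
      then show ?case using conj_transpose_pair[OF inv_closed[OF cH] Suc.IH] Suc.prems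
        by (simp add: comp_def)
    qed
    \<comment> \<open>At this \<open>i\<close> the moved points are 1, \<open>m + 1\<close>,
      \<open>2 * m + 2\<close>, \<open>2 * m + 1\<close>; for m \<ge> 2 they share only 1 with the
      points 1, 2, \<open>m + 2\<close>, \<open>3 * m + 1\<close> of \<open>ta\<close>.\<close>
    from this[of "m - 1"] have "transpose 1 (m + 1) \<circ> transpose (2 * m + 2) (2 * m + 1) \<in> H"
      using m by (simp add: numeral_eq_Suc)
    then have "three_cycle 1 2 (m + 1)"
      by (rule three_cycle_of_transposition_pairs[OF ta]) (use m2 in auto)
    then show ?thesis by blast
  qed
  then have one: "\<exists>u. three_cycle 1 (Suc 1) u" by (simp add: numeral_2_eq_2)
  have "\<exists>u. three_cycle i (Suc i) u" if "1 \<le> i" "i < 3 * m + 1" for i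
    using that
  proof (induction i rule: dec_induct)
    case base
    show ?case by (rule one)
  next
    case (step i)
    then obtain u where u: "three_cycle i (Suc i) u" by auto
    \<comment> \<open>\<open>a\<close> shifts the pair \<open>i, i + 1\<close> upwards until its
      upper end reaches \<open>2 * m + 1\<close>; from there on i \<ge> 2m \<ge> m+1, so
      \<open>c\<close> shifts it.\<close>
    show ?case
    proof (cases "i + 2 \<le> 2 * m + 1")
      case True
      then show ?thesis using three_cycle_conj[OF aH u] step.hyps by (auto simp: a_apply)
    next
      case False
      then show ?thesis using three_cycle_conj[OF cH u] step.prems m by (auto simp: c_apply)
    qed
  qed
  then show ?thesis using alt_group_subset_if_consecutive_three_cycles[OF assms(1)] by blast
qed

text \<open>Function composition goes from right to left here, unlike in \<^const>\<open>alt_group_lr\<close>.\<close>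

lemma two_cycles_product:
  fixes m :: nat
  assumes m: "m \<ge> 1"
  shows "cycle_of_list (rev [1..<m + 2] @ [2 * m + 2..<3 * m + 2]) \<circ> cycle_of_list [1..<2 * m + 2]
    = cycle_of_list [m + 1..<3 * m + 2]" (is "cycle_of_list ?bs \<circ> ?a = ?c")
proof
  fix x
  define cs where "cs = ?bs"
  have a_apply: "?a x = (if 1 \<le> x \<and> x < 2 * m + 1 then Suc x else if x = 2 * m + 1 then 1 else x)" for x
    using cycle_of_list_upt[of 1 "2 * m + 1" x] by simp
  have c_apply: "?c x = (if m + 1 \<le> x \<and> x < 3 * m + 1 then Suc x else if x = 3 * m + 1 then m + 1 else x)" for x
    using cycle_of_list_upt[of "m + 1" "3 * m + 1" x] by simp
  have cs: "cycle cs" "length cs = 2 * m + 1" by (auto simp: cs_def simp del: upt_Suc)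
  have nth: "cs ! i = (if i \<le> m then m + 1 - i else m + 1 + i)" if "i < 2 * m + 1" for i
    using that by (auto simp: cs_def nth_append rev_nth simp del: upt_Suc)
  have b_low: "cycle_of_list cs (Suc y) = y" if "1 \<le> y" "y \<le> m" for y
    using cycle_of_list_nth_Suc[OF cs(1), of "m - y"] nth[of "m - y"] nth[of "Suc (m - y)"] that cs(2)
    by auto
  have b_one: "cycle_of_list cs 1 = 2 * m + 2"
    using cycle_of_list_nth_Suc[OF cs(1), of m] nth[of m] nth[of "Suc m"] m cs(2) by auto
  have b_high: "cycle_of_list cs y = Suc y" if "2 * m + 2 \<le> y" "y < 3 * m + 1" for y
  proof -
    have "m + 1 \<le> y" using that by simp
    then obtain k where k: "y = m + 1 + k" by (metis le_iff_add)
    then show ?thesis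
      using cycle_of_list_nth_Suc[OF cs(1), of k] nth[of k] nth[of "Suc k"] that cs(2) by simp
  qed
  have b_last: "cycle_of_list cs (3 * m + 1) = m + 1"
    using cycle_of_list_last[OF cs(1)] m by (simp add: cs_def hd_append hd_rev last_upt del: upt_Suc)
  have b_out: "cycle_of_list cs y = y" if "y = 0 \<or> m + 1 < y \<and> y < 2 * m + 2 \<or> 3 * m + 1 < y" for y
    using that by (intro id_outside_supp) (auto simp: cs_def simp del: upt_Suc)
  \<comment> \<open>On 1, ..., m the second cycle undoes the shift by the first; on m+1, ..., 2m it
    fixes the shifted point; 2m+1 goes through 1 to 2m+2; above that only the second cycle acts,
    closing up at m+1.\<close>
  consider "1 \<le> x" "x \<le> m" | "m + 1 \<le> x" "x < 2 * m + 1" | "x = 2 * m + 1"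
    | "2 * m + 2 \<le> x" "x < 3 * m + 1" | "x = 3 * m + 1" | "x = 0 \<or> 3 * m + 1 < x" by linarith
  then show "(cycle_of_list ?bs \<circ> ?a) x = ?c x"
    unfolding comp_apply a_apply c_apply cs_def[symmetric]
    using b_low[of x] b_one b_high[of x] b_last b_out[of x] b_out[of "Suc x"] m
    by cases auto
qed

section \<open>The bitrade of a group with three generators of product one\<close>

lemma (in group) l_coset_eq_iff:
  assumes "subgroup H G" and "g \<in> carrier G" and "h \<in> carrier G"
  shows "g <# H = h <# H \<longleftrightarrow> inv g \<otimes> h \<in> H"
proof
  assume "g <# H = h <# H"
  then have "h \<in> g <# H" using lcos_self[OF assms(3,1)] by simp
  then show "inv g \<otimes> h \<in> H" using subgroup.lcos_module_imp[OF assms(1) is_group assms(2)] by blast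
next
  assume "inv g \<otimes> h \<in> H"
  then have "h \<in> g <# H"
    using subgroup.lcos_module_rev[OF assms(1) is_group assms(2,3)] by blast
  then show "g <# H = h <# H" by (rule l_repr_independence[OF _ assms(2,1)])
qed

lemma (in group) l_coset_mult_mem:
  assumes "subgroup H G" and "g \<in> carrier G" and "h \<in> H"
  shows "(g \<otimes> h) <# H = g <# H"
  using assms l_coset_eq_iff[of H g "g \<otimes> h"] subgroup.mem_carrier[OF assms(1,3)]
  by (simp add: inv_solve_left' m_assoc[symmetric])

text \<open>The quotient \<open>inv g \<otimes> h\<close> lies in both subgroups. This is why two
  coordinates of a triple determine the group element.\<close>

lemma (in group) l_coset_inter_trivial:
  assumes "subgroup H G" and "subgroup K G" and "H \<inter> K = {\<one>}"
    and "g \<in> carrier G" and "h \<in> carrier G"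
    and "g <# H = h <# H" and "g <# K = h <# K"
  shows "g = h"
proof -
  have "inv g \<otimes> h = \<one>" using assms l_coset_eq_iff by blast
  then show ?thesis using assms(4,5) by (simp add: inv_solve_left')
qed

text \<open>As \<open>g\<close> represents the common coset, it may replace \<open>h\<close> and
  then cancels. This yields the disjointness of rows, columns and symbols.\<close>

lemma (in group) l_coset_eq_imp_subgroup_eq:
  assumes "subgroup H G" and "subgroup K G" and g: "g \<in> carrier G" and h: "h \<in> carrier G"
    and eq: "g <# H = h <# K"
  shows "H = K"
proof -
  have "g <# H = g <# K"
    using lcos_self[OF g assms(1)] l_repr_independence[of g h K] eq h assms(2) by simp
  then have "inv g <# (g <# H) = inv g <# (g <# K)" by simp
  then show ?thesis
    using g subgroup.subset[OF assms(1)] subgroup.subset[OF assms(2)]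
    by (simp add: lcos_m_assoc lcos_mult_one)
qed

section \<open>Partial latin squares and bitrades in general\<close>

text \<open>Trades the cardinality form of (P1) for the rule that two shared coordinates force
  equality.\<close>

lemma partial_latin_squareI:
  assumes "finite A1" "finite A2" "finite A3" and "A1 \<noteq> {}" "A2 \<noteq> {}" "A3 \<noteq> {}"
    and "A1 \<inter> A2 = {}" "A1 \<inter> A3 = {}" "A2 \<inter> A3 = {}" and "T \<subseteq> A1 \<times> A2 \<times> A3"
    and two: "\<And>t u r s. t \<in> T \<Longrightarrow> u \<in> T \<Longrightarrow> r \<in> {1, 2, 3} \<Longrightarrow> s \<in> {1, 2, 3} \<Longrightarrow> r \<noteq> s \<Longrightarrow>
      coord r t = coord r u \<Longrightarrow> coord s t = coord s u \<Longrightarrow> t = u"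
    and "A1 \<subseteq> coord 1 ` T" "A2 \<subseteq> coord 2 ` T" "A3 \<subseteq> coord 3 ` T"
  shows "partial_latin_square A1 A2 A3 T"
proof -
  have "card {r \<in> {1, 2, 3}. coord r t = coord r u} \<le> 1 \<or> (\<forall>r\<in>{1, 2, 3}. coord r t = coord r u)"
    if "t \<in> T" "u \<in> T" for t u
  proof (cases "t = u")
    case False
    then have "card {r \<in> {1, 2, 3}. coord r t = coord r u} \<le> Suc 0"
      using two[OF that] by (subst card_le_Suc0_iff_eq) auto
    then show ?thesis by simp
  qed simp
  moreover have "\<exists>t\<in>T. \<exists>r\<in>{1, 2, 3}. coord r t = x" if "x \<in> A1 \<union> A2 \<union> A3" for x
    using that assms(12-14) by blast
  ultimately show ?thesis using assms(1-10) unfolding partial_latin_square_def by blast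
qed

lemma partial_latin_square_nonempty:
  assumes "partial_latin_square A1 A2 A3 T"
  shows "T \<noteq> {}"
  using assms by (auto simp: partial_latin_square_def)

lemma latin_bitrade_mateD:
  assumes "latin_bitrade A1 A2 A3 T T'" and "r \<in> {1, 2, 3}" "s \<in> {1, 2, 3}" "r \<noteq> s"
  shows "t \<in> T \<Longrightarrow> \<exists>u\<in>T'. coord r t = coord r u \<and> coord s t = coord s u"
    and "t \<in> T' \<Longrightarrow> \<exists>u\<in>T. coord r t = coord r u \<and> coord s t = coord s u"
proof -
  note mates = assms(1)[unfolded latin_bitrade_def, THEN conjunct2, THEN conjunct2, THEN conjunct2]
  note mates[THEN conjunct1, rule_format, OF _ assms(2-4)] mates[THEN conjunct2, rule_format, OF _ assms(2-4)]
  then show "t \<in> T \<Longrightarrow> \<exists>u\<in>T'. coord r t = coord r u \<and> coord s t = coord s u"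
    and "t \<in> T' \<Longrightarrow> \<exists>u\<in>T. coord r t = coord r u \<and> coord s t = coord s u"
    by (meson ex1_implies_ex)+
qed

text \<open>Non-triviality of \<alpha> and \<beta> keeps the three sets of cosets disjoint, and that
  of \<alpha> also separates \<open>T\<close> from \<open>T'\<close>. Generation of \<open>G\<close>
  enters with primarity.\<close>

locale bitrade_group = group G for G (structure) +
  fixes A B C \<alpha> \<beta> \<gamma>
  assumes finite_carrier: "finite (carrier G)"
    and subgroups: "subgroup A G" "subgroup B G" "subgroup C G"
    and gens: "\<alpha> \<in> A" "\<beta> \<in> B" "\<gamma> \<in> C"
    and prod_one: "\<alpha> \<otimes> \<beta> \<otimes> \<gamma> = \<one>"
    and inter: "A \<inter> B = {\<one>}" "A \<inter> C = {\<one>}" "B \<inter> C = {\<one>}"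
    and nontrivial: "\<alpha> \<noteq> \<one>" "\<beta> \<noteq> \<one>"
begin

definition tri :: "'a \<Rightarrow> 'a set \<times> 'a set \<times> 'a set" where
  "tri g = (g <# A, g <# B, g <# C)"

definition tri' :: "'a \<Rightarrow> 'a set \<times> 'a set \<times> 'a set" where
  "tri' g = (g <# A, g <# B, (g \<otimes> inv \<alpha>) <# C)"

abbreviation T where "T \<equiv> tri ` carrier G"
abbreviation T' where "T' \<equiv> tri' ` carrier G"

lemma gens_closed [simp]: "\<alpha> \<in> carrier G" "\<beta> \<in> carrier G" "\<gamma> \<in> carrier G"
  by (rule subgroup.mem_carrier[OF subgroups(1) gens(1)] subgroup.mem_carrier[OF subgroups(2) gens(2)]
      subgroup.mem_carrier[OF subgroups(3) gens(3)])+

lemma mult_gens [simp]: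
  assumes "g \<in> carrier G"
  shows "(g \<otimes> \<alpha>) <# A = g <# A" "(g \<otimes> inv \<alpha>) <# A = g <# A"
    "(g \<otimes> \<beta>) <# B = g <# B" "(g \<otimes> inv \<beta>) <# B = g <# B"
  using l_coset_mult_mem[OF subgroups(1) assms gens(1)] l_coset_mult_mem[OF subgroups(2) assms gens(2)]
    l_coset_mult_mem[OF subgroups(1) assms subgroup.m_inv_closed[OF subgroups(1) gens(1)]]
    l_coset_mult_mem[OF subgroups(2) assms subgroup.m_inv_closed[OF subgroups(2) gens(2)]]
  by simp_all

lemma gamma_eq: "\<gamma> = inv (\<alpha> \<otimes> \<beta>)"
  using inv_equality[OF inv_comm[OF prod_one]] by simp

text \<open>Product one gives \<beta> = \<alpha>^-1 \<gamma>^-1, and \<open>C\<close> absorbs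
  \<gamma>^-1.\<close>

lemma mult_beta_C:
  assumes "g \<in> carrier G"
  shows "(g \<otimes> \<beta>) <# C = (g \<otimes> inv \<alpha>) <# C"
proof -
  have "inv \<alpha> \<otimes> (\<alpha> \<otimes> \<beta>) = \<beta>" by (simp add: m_assoc[symmetric])
  then have "g \<otimes> \<beta> = g \<otimes> inv \<alpha> \<otimes> inv \<gamma>"
    using assms by (simp add: gamma_eq m_assoc)
  then show ?thesis
    using l_coset_mult_mem[OF subgroups(3), of "g \<otimes> inv \<alpha>" "inv \<gamma>"] assms subgroups(3) gens(3)
    by (simp add: subgroup.m_inv_closed)
qed

text \<open>The variant at \<open>Suc 0\<close> is what the simplifier makes of the index
  \<open>1\<close>.\<close>

lemma coord_tri [simp]:
  "coord 1 (tri g) = g <# A" "coord (Suc 0) (tri g) = g <# A"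
  "coord 2 (tri g) = g <# B" "coord 3 (tri g) = g <# C"
  by (simp_all add: tri_def coord_def)

lemma coord_tri' [simp]:
  "coord 1 (tri' g) = g <# A" "coord (Suc 0) (tri' g) = g <# A"
  "coord 2 (tri' g) = g <# B" "coord 3 (tri' g) = (g \<otimes> inv \<alpha>) <# C"
  by (simp_all add: tri'_def coord_def)

lemma tri_eq_if_two_coords:
  assumes "g \<in> carrier G" "h \<in> carrier G" "r \<in> {1, 2, 3}" "s \<in> {1, 2, 3}" "r \<noteq> s"
    and "coord r (tri g) = coord r (tri h)" "coord s (tri g) = coord s (tri h)"
  shows "g = h"
proof -
  note triv = l_coset_inter_trivial[OF subgroups(1,2) inter(1) assms(1,2)]
    l_coset_inter_trivial[OF subgroups(1,3) inter(2) assms(1,2)]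
    l_coset_inter_trivial[OF subgroups(2,3) inter(3) assms(1,2)]
  show ?thesis using assms(3-7) by (auto intro: triv)
qed

text \<open>For distinct \<open>r, s\<close> in \<open>{1, 2, 3}\<close>, the index \<open>h\<close> for which \<open>tri h\<close> agrees with \<open>tri' g\<close> in
  the coordinates \<open>r\<close> and \<open>s\<close>.\<close>

definition partner :: "nat \<Rightarrow> nat \<Rightarrow> 'a \<Rightarrow> 'a" where
  "partner r s g =
    (if {r, s} = {1, 2} then g else if {r, s} = {1, 3} then g \<otimes> inv \<alpha> else g \<otimes> \<beta>)"

lemma partner_closed: "g \<in> carrier G \<Longrightarrow> partner r s g \<in> carrier G"
  by (simp add: partner_def)

lemma coord_partner:
  assumes "g \<in> carrier G" "r \<in> {1, 2, 3}" "s \<in> {1, 2, 3}" "r \<noteq> s"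
  shows "coord r (tri (partner r s g)) = coord r (tri' g)"
    and "coord s (tri (partner r s g)) = coord s (tri' g)"
  using assms by (auto simp: partner_def doubleton_eq_iff mult_beta_C)

lemma partner_inj: "g \<in> carrier G \<Longrightarrow> h \<in> carrier G \<Longrightarrow> partner r s g = partner r s h \<Longrightarrow> g = h"
  by (simp add: partner_def split: if_splits)

text \<open>An injective self-map of the finite carrier is onto. So every triple of \<open>T\<close>
  is met from \<open>T'\<close>, for each pair of coordinates.\<close>

lemma partner_surj:
  assumes "g \<in> carrier G"
  shows "\<exists>h\<in>carrier G. partner r s h = g"
proof -
  have "inj_on (partner r s) (carrier G)" by (rule inj_onI) (rule partner_inj)
  moreover have "partner r s ` carrier G \<subseteq> carrier G" using partner_closed by blast
  ultimately have "partner r s ` carrier G = carrier G" using endo_inj_surj[OF finite_carrier] by blast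
  then have "g \<in> partner r s ` carrier G" using assms by simp
  then show ?thesis by blast
qed

lemma inj_on_tri: "inj_on tri (carrier G)"
  by (rule inj_onI, rule tri_eq_if_two_coords[of _ _ 1 2]) simp_all

text \<open>The two coordinates are those of \<open>tri\<close> at the partners, so the partners
  agree, and \<open>partner r s\<close> is injective.\<close>

lemma tri'_eq_if_two_coords:
  assumes "g \<in> carrier G" "h \<in> carrier G" "r \<in> {1, 2, 3}" "s \<in> {1, 2, 3}" "r \<noteq> s"
    and "coord r (tri' g) = coord r (tri' h)" "coord s (tri' g) = coord s (tri' h)"
  shows "g = h"
proof -
  have "partner r s g = partner r s h"
    using tri_eq_if_two_coords[OF partner_closed[OF assms(1)] partner_closed[OF assms(2)] assms(3-5)]
      coord_partner[OF assms(1,3-5)] coord_partner[OF assms(2,3-5)] assms(6,7) by simp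
  then show ?thesis by (rule partner_inj[OF assms(1,2)])
qed

lemma inj_on_tri': "inj_on tri' (carrier G)"
  by (rule inj_onI, rule tri'_eq_if_two_coords[of _ _ 1 2]) simp_all

lemma lcosets_eq: "lcosets H = (\<lambda>g. g <# H) ` carrier G"
  by (auto simp: LCOSETS_def)

lemma lcosets_disjoint:
  assumes "subgroup H G" "subgroup K G" "H \<inter> K = {\<one>}" "x \<in> H" "x \<noteq> \<one>"
  shows "lcosets H \<inter> lcosets K = {}"
proof (rule ccontr)
  assume "lcosets H \<inter> lcosets K \<noteq> {}"
  then obtain g h where "g \<in> carrier G" "h \<in> carrier G" "g <# H = h <# K"
    unfolding lcosets_eq by blast
  then have "H = K" using l_coset_eq_imp_subgroup_eq[OF assms(1,2)] by blast
  then show False using assms(3-5) by blast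
qed

lemma lcosets_ABC:
  "finite (lcosets A)" "finite (lcosets B)" "finite (lcosets C)"
  "lcosets A \<noteq> {}" "lcosets B \<noteq> {}" "lcosets C \<noteq> {}"
  "lcosets A \<inter> lcosets B = {}" "lcosets A \<inter> lcosets C = {}" "lcosets B \<inter> lcosets C = {}"
  using finite_carrier lcosets_disjoint[OF subgroups(1,2) inter(1) gens(1) nontrivial(1)]
    lcosets_disjoint[OF subgroups(1,3) inter(2) gens(1) nontrivial(1)]
    lcosets_disjoint[OF subgroups(2,3) inter(3) gens(2) nontrivial(2)]
  by (auto simp: lcosets_eq simp del: One_nat_def)

lemma partial_latin_square_tri: "partial_latin_square (lcosets A) (lcosets B) (lcosets C) T"
proof (rule partial_latin_squareI[OF lcosets_ABC])
  show "T \<subseteq> (lcosets A) \<times> (lcosets B) \<times> (lcosets C)"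
    by (auto simp: tri_def lcosets_eq)
  show "t = u" if "t \<in> T" "u \<in> T" "r \<in> {1, 2, 3}" "s \<in> {1, 2, 3}" "r \<noteq> s"
    "coord r t = coord r u" "coord s t = coord s u" for t u r s
  proof -
    from that(1,2) obtain g h where "g \<in> carrier G" "t = tri g" "h \<in> carrier G" "u = tri h"
      by blast
    then show ?thesis using tri_eq_if_two_coords[of g h r s] that(3-7) by simp
  qed
qed (auto simp: lcosets_eq image_image)

lemma partial_latin_square_tri': "partial_latin_square (lcosets A) (lcosets B) (lcosets C) T'"
proof (rule partial_latin_squareI[OF lcosets_ABC])
  show "T' \<subseteq> (lcosets A) \<times> (lcosets B) \<times> (lcosets C)"
    by (auto simp: tri'_def lcosets_eq)
  show "t = u" if "t \<in> T'" "u \<in> T'" "r \<in> {1, 2, 3}" "s \<in> {1, 2, 3}" "r \<noteq> s"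
    "coord r t = coord r u" "coord s t = coord s u" for t u r s
  proof -
    from that(1,2) obtain g h where "g \<in> carrier G" "t = tri' g" "h \<in> carrier G" "u = tri' h"
      by blast
    then show ?thesis using tri'_eq_if_two_coords[of g h r s] that(3-7) by simp
  qed
  show "lcosets C \<subseteq> coord 3 ` T'"
  proof
    fix x assume "x \<in> lcosets C"
    then obtain g where g: "g \<in> carrier G" "x = g <# C" by (auto simp: lcosets_eq)
    \<comment> \<open>The symbol of \<open>tri' h\<close> is the coset of
      \<open>h \<otimes> inv \<alpha>\<close>, so \<open>h\<close> has to solve
      \<open>h \<otimes> inv \<alpha> = g\<close>.\<close>
    obtain h where h: "h \<in> carrier G" "partner 1 3 h = g" using partner_surj[OF g(1)] by blast
    have "coord 3 (tri' h) = x"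
      using coord_partner(2)[OF h(1), of 1 3] g(2) h(2) by (simp only: coord_tri) simp
    then show "x \<in> coord 3 ` T'" using h(1) by blast
  qed
qed (auto simp: lcosets_eq image_image)

text \<open>The mate is \<open>tri' h\<close> for the \<open>h\<close> whose partner is
  \<open>g\<close>; two coordinates leave no other choice.\<close>

lemma tri_tri'_unique:
  assumes g: "g \<in> carrier G" and rs: "r \<in> {1, 2, 3}" "s \<in> {1, 2, 3}" "r \<noteq> s"
  shows "\<exists>!u. u \<in> T' \<and> coord r (tri g) = coord r u \<and> coord s (tri g) = coord s u"
proof -
  obtain h where h: "h \<in> carrier G" "partner r s h = g" using partner_surj[OF g] by blast
  note eq = coord_partner[OF h(1) rs, unfolded h(2)]
  show ?thesis
  proof (intro ex1I[of _ "tri' h"] conjI eq)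
    show "u = tri' h" if u: "u \<in> T' \<and> coord r (tri g) = coord r u \<and> coord s (tri g) = coord s u" for u
    proof -
      obtain k where "k \<in> carrier G" "u = tri' k" using u by blast
      then show ?thesis using u eq tri'_eq_if_two_coords[OF _ h(1) rs, of k] by simp
    qed
  qed (use h in blast)
qed

lemma tri'_tri_unique:
  assumes g: "g \<in> carrier G" and rs: "r \<in> {1, 2, 3}" "s \<in> {1, 2, 3}" "r \<noteq> s"
  shows "\<exists>!u. u \<in> T \<and> coord r (tri' g) = coord r u \<and> coord s (tri' g) = coord s u"
proof -
  note eq = coord_partner[OF g rs, symmetric]
  note closed = partner_closed[OF g, of r s]
  show ?thesis
  proof (intro ex1I[of _ "tri (partner r s g)"] conjI eq)
    show "u = tri (partner r s g)"
      if u: "u \<in> T \<and> coord r (tri' g) = coord r u \<and> coord s (tri' g) = coord s u" for u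
    proof -
      obtain k where "k \<in> carrier G" "u = tri k" using u by blast
      then show ?thesis using u eq tri_eq_if_two_coords[OF _ closed rs, of k] by simp
    qed
  qed (use closed in blast)
qed

text \<open>Equality would make \<open>g\<close> every partner of \<open>h\<close>, in particular
  both \<open>h\<close> and \<open>h \<otimes> inv \<alpha>\<close>, against \<alpha> \<noteq>
  1.\<close>

lemma tri_neq_tri':
  assumes "g \<in> carrier G" and "h \<in> carrier G"
  shows "tri g \<noteq> tri' h"
proof
  assume eq: "tri g = tri' h"
  have "g = partner r s h" if rs: "r \<in> {1, 2, 3}" "s \<in> {1, 2, 3}" "r \<noteq> s" for r s
    using tri_eq_if_two_coords[OF assms(1) partner_closed[OF assms(2)] rs]
      coord_partner[OF assms(2) rs] eq by simp
  from this[of 1 2] this[of 1 3] have "partner 1 3 h = partner 1 2 h" by simp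
  then have "h \<otimes> inv \<alpha> = h" by (simp add: partner_def doubleton_eq_iff)
  then show False using assms(2) nontrivial(1) by (simp add: r_cancel_one)
qed

lemma latin_bitrade_tri: "latin_bitrade (lcosets A) (lcosets B) (lcosets C) T T'"
  unfolding latin_bitrade_def
proof (intro conjI ballI impI)
  show "T \<inter> T' = {}" using tri_neq_tri' by blast
next
  fix t and r s :: nat
  assume rs: "r \<in> {1, 2, 3}" "s \<in> {1, 2, 3}" "r \<noteq> s"
  show "\<exists>!u. u \<in> T' \<and> coord r t = coord r u \<and> coord s t = coord s u" if t: "t \<in> T"
    using t tri_tri'_unique[OF _ rs] by (elim imageE) (simp only:)
  show "\<exists>!u. u \<in> T \<and> coord r t = coord r u \<and> coord s t = coord s u" if t: "t \<in> T'"
    using t tri'_tri_unique[OF _ rs] by (elim imageE) (simp only:)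
qed (rule partial_latin_square_tri partial_latin_square_tri')+

section \<open>Primarity and homogeneity\<close>

text \<open>A mate inside the smaller bitrade is also a mate in \<open>T\<close> or
  \<open>T'\<close>, where mates are unique; so it is the expected triple.\<close>

lemma bitrade_subset_closed:
  assumes U: "latin_bitrade B1 B2 B3 U U'" "U \<subseteq> T" "U' \<subseteq> T'"
    and rs: "r \<in> {1, 2, 3}" "s \<in> {1, 2, 3}" "r \<noteq> s" and g: "g \<in> carrier G"
  shows "tri (partner r s g) \<in> U \<longleftrightarrow> tri' g \<in> U'"
proof
  assume "tri (partner r s g) \<in> U"
  then obtain u where u: "u \<in> U'" "coord r (tri (partner r s g)) = coord r u"
    "coord s (tri (partner r s g)) = coord s u"
    using latin_bitrade_mateD(1)[OF U(1) rs] by blast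
  then obtain h where h: "h \<in> carrier G" "u = tri' h" using U(3) by blast
  then have "g = h" using u coord_partner[OF g rs] tri'_eq_if_two_coords[OF g h(1) rs] by simp
  then show "tri' g \<in> U'" using u h by simp
next
  assume "tri' g \<in> U'"
  then obtain u where u: "u \<in> U" "coord r (tri' g) = coord r u" "coord s (tri' g) = coord s u"
    using latin_bitrade_mateD(2)[OF U(1) rs] by blast
  then obtain h where h: "h \<in> carrier G" "u = tri h" using U(2) by blast
  then have "partner r s g = h"
    using u coord_partner[OF g rs] tri_eq_if_two_coords[OF partner_closed[OF g] h(1) rs] by simp
  then show "tri (partner r s g) \<in> U" using u h by simp
qed

lemma primary_bitrade_tri:
  assumes gen: "generate G {\<alpha>, \<beta>, \<gamma>} = carrier G"
  shows "primary_bitrade (lcosets A) (lcosets B) (lcosets C) T T'"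
  unfolding primary_bitrade_def
proof (intro conjI latin_bitrade_tri allI impI; elim conjE)
  fix B1 B2 B3 U U'
  assume U: "latin_bitrade B1 B2 B3 U U'" "U \<subseteq> T" "U' \<subseteq> T'"
  note closed = bitrade_subset_closed[OF U]
  \<comment> \<open>\<open>S\<close> indexes the triples of \<open>U\<close> and, by the mates in
    coordinates 1, 2, also those of \<open>U'\<close>. The other two pairs of coordinates give
    invariance under right multiplication by \<alpha>^-1 and by \<beta>.\<close>
  define S where "S = {g \<in> carrier G. tri g \<in> U}"
  have S': "tri' g \<in> U' \<longleftrightarrow> g \<in> S" if "g \<in> carrier G" for g
    using closed[of 1 2 g] that by (simp add: S_def partner_def)
  have inv_alpha: "g \<otimes> inv \<alpha> \<in> S \<longleftrightarrow> g \<in> S" if "g \<in> carrier G" for g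
    using closed[of 1 3 g] that S' by (simp add: S_def partner_def doubleton_eq_iff)
  have beta: "g \<otimes> \<beta> \<in> S \<longleftrightarrow> g \<in> S" if "g \<in> carrier G" for g
    using closed[of 2 3 g] that S' by (simp add: S_def partner_def doubleton_eq_iff)
  have alpha: "g \<otimes> \<alpha> \<in> S \<longleftrightarrow> g \<in> S" if "g \<in> carrier G" for g
    using inv_alpha[of "g \<otimes> \<alpha>"] that by (simp add: m_assoc)
  have inv_beta: "g \<otimes> inv \<beta> \<in> S \<longleftrightarrow> g \<in> S" if "g \<in> carrier G" for g
    using beta[of "g \<otimes> inv \<beta>"] that by (simp add: m_assoc)
  have gamma: "g \<otimes> \<gamma> \<in> S \<longleftrightarrow> g \<in> S" if "g \<in> carrier G" for g
  proof -
    have "g \<otimes> \<gamma> = g \<otimes> inv \<beta> \<otimes> inv \<alpha>" using that by (simp add: gamma_eq inv_mult_group m_assoc)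
    then show ?thesis using inv_alpha[of "g \<otimes> inv \<beta>"] inv_beta that by simp
  qed
  have inv_gamma: "g \<otimes> inv \<gamma> \<in> S \<longleftrightarrow> g \<in> S" if "g \<in> carrier G" for g
    using gamma[of "g \<otimes> inv \<gamma>"] that by (simp add: m_assoc)
  \<comment> \<open>As an equivalence for all \<open>g\<close>, the property passes through
    products: \<open>g \<otimes> h1\<close> takes the place of \<open>g\<close>.\<close>
  have mult: "g \<otimes> h \<in> S \<longleftrightarrow> g \<in> S" if "g \<in> carrier G" "h \<in> generate G {\<alpha>, \<beta>, \<gamma>}" for g h
    using that(2,1)
  proof (induction h arbitrary: g rule: generate.induct)
    case (eng h1 h2)
    then have "h1 \<in> carrier G" "h2 \<in> carrier G" using gen by auto
    then show ?case using eng by (simp add: m_assoc[symmetric])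
  qed (auto simp: alpha beta gamma inv_alpha inv_beta inv_gamma)
  \<comment> \<open>A bitrade is non-empty, so \<open>S\<close> has an element \<open>g\<close>;
    multiplication by \<open>inv g \<otimes> h\<close> leads from it to any
    \<open>h\<close>.\<close>
  have "U \<noteq> {}"
    using conjunct1[OF U(1)[unfolded latin_bitrade_def]] by (rule partial_latin_square_nonempty)
  then obtain g where g: "g \<in> S" using U(2) unfolding S_def by blast
  then have gc: "g \<in> carrier G" by (simp add: S_def)
  have S: "h \<in> S" if "h \<in> carrier G" for h
  proof -
    have "g \<otimes> (inv g \<otimes> h) = h" using gc that by (simp add: m_assoc[symmetric])
    then show ?thesis using mult[of g "inv g \<otimes> h"] g gc that gen by simp
  qed
  then have "T \<subseteq> U" unfolding S_def by blast
  then show "U = T" using U(2) by blast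
  have "T' \<subseteq> U'" using S S' by blast
  then show "U' = T'" using U(3) by blast
qed

lemma card_l_coset: "subgroup H G \<Longrightarrow> g \<in> carrier G \<Longrightarrow> card (g <# H) = card H"
  unfolding l_coset_def using subgroup.subset[of H G]
  by (simp add: UNION_singleton_eq_range card_image inj_on_def subset_iff)

text \<open>The triples over the coset of \<open>g\<close> are indexed injectively by the elements
  of that coset.\<close>

lemma card_tri_fiber:
  assumes H: "subgroup H G" and coord: "\<And>g. coord r (tri g) = g <# H" and x: "x \<in> lcosets H"
  shows "card {t \<in> T. coord r t = x} = card H"
proof -
  obtain g where g: "g \<in> carrier G" "x = g <# H" using x by (auto simp: lcosets_eq)
  have "h <# H = g <# H \<longleftrightarrow> h \<in> g <# H" if "h \<in> carrier G" for h
    using lcos_self[OF that H] l_repr_independence[OF _ g(1) H, of h] by auto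
  moreover have "g <# H \<subseteq> carrier G" using l_coset_carrier[OF _ g(1) H] by blast
  ultimately have "{h \<in> carrier G. h <# H = x} = g <# H" using g(2) by blast
  moreover have "{t \<in> T. coord r t = x} = tri ` {h \<in> carrier G. h <# H = x}"
    using coord by auto
  ultimately have "{t \<in> T. coord r t = x} = tri ` (g <# H)" by simp
  moreover have "inj_on tri (g <# H)"
    using inj_on_tri l_coset_carrier[OF _ g(1) H] by (auto simp: inj_on_def)
  ultimately show ?thesis using card_l_coset[OF H g(1)] by (simp add: card_image)
qed

lemma homogeneous_bitrade_tri:
  assumes "card A = k" "card B = k" "card C = k"
  shows "homogeneous_bitrade k (lcosets A) (lcosets B) (lcosets C) T T'"
  unfolding homogeneous_bitrade_def
  using latin_bitrade_tri card_tri_fiber[OF subgroups(1) coord_tri(1)]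
    card_tri_fiber[OF subgroups(2) coord_tri(3)] card_tri_fiber[OF subgroups(3) coord_tri(4)] assms
  by (intro conjI ballI) (simp_all only:)

end

section \<open>The alternating group\<close>

lemma alt_group_lr_simps [simp]:
  "carrier (alt_group_lr n) = carrier (alt_group n)"
  "p \<otimes>\<^bsub>alt_group_lr n\<^esub> q = q \<circ> p"
  "\<one>\<^bsub>alt_group_lr n\<^esub> = id"
  by (simp_all add: alt_group_lr_def alt_group_one)

lemma alt_group_lr_is_group: "group (alt_group_lr n)"
proof (rule groupI)
  interpret alt: group "alt_group n" by (rule alt_group_is_group)
  fix p q assume p: "p \<in> carrier (alt_group_lr n)" and q: "q \<in> carrier (alt_group_lr n)"
  show "p \<otimes>\<^bsub>alt_group_lr n\<^esub> q \<in> carrier (alt_group_lr n)"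
    using p q alt.m_closed[of q p] by (simp add: alt_group_mult)
  \<comment> \<open>With the factors swapped, a left inverse is a right inverse in
    \<open>alt_group n\<close>.\<close>
  show "\<exists>r\<in>carrier (alt_group_lr n). r \<otimes>\<^bsub>alt_group_lr n\<^esub> p = \<one>\<^bsub>alt_group_lr n\<^esub>"
    using p alt.r_inv[of p] alt.inv_closed[of p] by (auto simp: alt_group_mult alt_group_one)
next
  show "\<one>\<^bsub>alt_group_lr n\<^esub> \<in> carrier (alt_group_lr n)"
    using group.is_monoid[OF alt_group_is_group[of n], THEN monoid.one_closed]
    by (simp add: alt_group_one)
qed (simp_all add: comp_assoc)

lemma alt_group_lr_inv:
  assumes "p \<in> carrier (alt_group n)"
  shows "inv\<^bsub>alt_group_lr n\<^esub> p = inv' p"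
proof (rule group.inv_equality[OF alt_group_lr_is_group])
  show "inv' p \<otimes>\<^bsub>alt_group_lr n\<^esub> p = \<one>\<^bsub>alt_group_lr n\<^esub>"
    using assms permutes_inv_o(1)[of p "{1..n}"] by (simp add: alt_group_carrier)
qed (use assms alt_group_inv_closed in simp_all)

lemma alt_group_lr_pow: "p [^]\<^bsub>alt_group_lr n\<^esub> (k :: nat) = p ^^ k"
  by (induction k) (simp_all add: nat_pow_def)

lemma finite_alt_group: "finite (carrier (alt_group n))"
proof (rule finite_subset)
  show "carrier (alt_group n) \<subseteq> {p. p permutes {1..n}}" using alt_group_carrier by blast
qed (simp add: finite_permutations)

lemma perm_group_generate_alt_group_lr:
  assumes "S \<subseteq> carrier (alt_group n)"
  shows "perm_group (generate (alt_group_lr n) S)"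
proof -
  interpret group "alt_group_lr n" by (rule alt_group_lr_is_group)
  have carrier: "generate (alt_group_lr n) S \<subseteq> carrier (alt_group n)"
    using generate_incl[of S] assms by simp
  show ?thesis
  proof
    show "id \<in> generate (alt_group_lr n) S" using generate.one[of "alt_group_lr n" S] by simp
    fix p assume p: "p \<in> generate (alt_group_lr n) S"
    then have pc: "p \<in> carrier (alt_group n)" using carrier by blast
    then show "bij p" using alt_group_carrier permutes_bij by blast
    show "inv' p \<in> generate (alt_group_lr n) S"
      using generate_m_inv_closed[of S p] p assms by (simp add: alt_group_lr_inv[OF pc])
    show "p \<circ> q \<in> generate (alt_group_lr n) S" if "q \<in> generate (alt_group_lr n) S" for q
      using generate.eng[OF that p] by simp
  qed
qed

section \<open>Cyclic groups generated by cycles of odd length\<close>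

lemma cycle_in_alt_group:
  assumes "cycle cs" "odd (length cs)" "set cs \<subseteq> {1..n}"
  shows "cycle_of_list cs \<in> carrier (alt_group n)"
  using evenperm_cycle_of_list[OF assms(1,2)] permutes_subset[OF cycle_permutes assms(3)]
  by (simp add: alt_group_carrier)

text \<open>The order of a cycle is its length; being finite, it lets natural powers exhaust the
  generated group.\<close>

lemma generate_cycle:
  assumes "cycle cs" "odd (length cs)" "set cs \<subseteq> {1..n}"
  defines "p \<equiv> cycle_of_list cs"
  shows "generate (alt_group_lr n) {p} = range (\<lambda>k. p ^^ k)"
    and "card (generate (alt_group_lr n) {p}) = length cs"
proof -
  interpret group "alt_group_lr n" by (rule alt_group_lr_is_group)
  have p: "p \<in> carrier (alt_group_lr n)" using cycle_in_alt_group[OF assms(1-3)] by (simp add: p_def)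
  have "cs \<noteq> []" using assms(2) by auto
  then have ord: "ord p = length cs"
    using ord_unique[OF p] cycle_power_eq_id_iff(2)[OF assms(1) hd_in_set]
    by (simp add: alt_group_lr_pow p_def)
  then show "card (generate (alt_group_lr n) {p}) = length cs" using generate_pow_card[OF p] by simp
  have "ord p \<noteq> 0" using ord \<open>cs \<noteq> []\<close> by simp
  then show "generate (alt_group_lr n) {p} = range (\<lambda>k. p ^^ k)"
    using generate_pow_nat[OF p] by (auto simp: alt_group_lr_pow)
qed

text \<open>A common element fixes \<open>x\<close> as a power of the second cycle, and a power of
  the first cycle fixing \<open>x\<close> is the identity.\<close>

lemma generate_cycle_inter_trivial:
  assumes cs: "cycle cs" "odd (length cs)" "set cs \<subseteq> {1..n}"
    and ds: "cycle ds" "odd (length ds)" "set ds \<subseteq> {1..n}"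
    and x: "x \<in> set cs" "x \<notin> set ds"
  shows "generate (alt_group_lr n) {cycle_of_list cs} \<inter> generate (alt_group_lr n) {cycle_of_list ds} = {id}"
proof -
  have "p = id"
    if "p \<in> generate (alt_group_lr n) {cycle_of_list cs}" "p \<in> generate (alt_group_lr n) {cycle_of_list ds}" for p
  proof -
    from that obtain k l where k: "p = cycle_of_list cs ^^ k" and l: "p = cycle_of_list ds ^^ l"
      unfolding generate_cycle(1)[OF cs] generate_cycle(1)[OF ds] by blast
    have "(cycle_of_list ds ^^ l) x = x"
      using id_outside_supp[OF x(2)] by (induction l) simp_all
    then show "p = id"
      using cycle_power_eq_id_iff[OF cs(1) x(1), of k] k l by simp
  qed
  moreover have "id \<in> generate (alt_group_lr n) S" for S
    using generate.one[of "alt_group_lr n" S] by simp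
  ultimately show ?thesis by blast
qed

text \<open>Lets the cycle \<open>c\<close> stand in for \<open>\<gamma> = inv c\<close> as
  generator of \<open>C\<close>.\<close>

lemma (in group) generate_inv_singleton:
  assumes "x \<in> carrier G"
  shows "generate G {inv x} = generate G {x}"
proof
  have sub: "subgroup (generate G {x}) G" "subgroup (generate G {inv x}) G"
    using assms by (simp_all add: generate_is_subgroup)
  show "generate G {inv x} \<subseteq> generate G {x}"
    using generate_subgroup_incl[OF _ sub(1)] generate.inv[of x "{x}" G] by blast
  have "x \<in> generate G {inv x}"
    using generate.inv[of "inv x" "{inv x}" G] assms by simp
  then show "generate G {x} \<subseteq> generate G {inv x}"
    using generate_subgroup_incl[OF _ sub(2)] by blast
qed

section \<open>The bitrade of the cycles \<open>a\<close>, \<open>b\<close> and the inverse of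
  \<open>c\<close>\<close>

theorem theorem4p17:
  fixes m :: nat
    and G :: "(nat \<Rightarrow> nat) monoid"
    and a b c \<alpha> \<beta> \<gamma> :: "nat \<Rightarrow> nat"
    and A B C :: "(nat \<Rightarrow> nat) set"
    and T T' :: "((nat \<Rightarrow> nat) set \<times> (nat \<Rightarrow> nat) set \<times> (nat \<Rightarrow> nat) set) set"
  assumes "m \<ge> 1"
    and "G = alt_group_lr (3 * m + 1)"
    and "a = cycle_of_list [1..<2 * m + 2]"
    and "b = cycle_of_list (rev [1..<m + 2] @ [2 * m + 2..<3 * m + 2])"
    and "c = a \<otimes>\<^bsub>G\<^esub> b"
    and "\<alpha> = a" and "\<beta> = b" and "\<gamma> = inv\<^bsub>G\<^esub> c"
    and "A = generate G {\<alpha>}" and "B = generate G {\<beta>}" and "C = generate G {\<gamma>}"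
    and "T = {(g <#\<^bsub>G\<^esub> A, g <#\<^bsub>G\<^esub> B, g <#\<^bsub>G\<^esub> C) | g. g \<in> carrier G}"
    and "T' = {(g <#\<^bsub>G\<^esub> A, g <#\<^bsub>G\<^esub> B, (g \<otimes>\<^bsub>G\<^esub> inv\<^bsub>G\<^esub> \<alpha>) <#\<^bsub>G\<^esub> C) | g. g \<in> carrier G}"
  shows "\<alpha> \<in> carrier G \<and> \<beta> \<in> carrier G \<and> \<gamma> \<in> carrier G \<and>
    \<alpha> \<otimes>\<^bsub>G\<^esub> \<beta> \<otimes>\<^bsub>G\<^esub> \<gamma> = \<one>\<^bsub>G\<^esub> \<and>
    A \<inter> B = {\<one>\<^bsub>G\<^esub>} \<and> A \<inter> C = {\<one>\<^bsub>G\<^esub>} \<and> B \<inter> C = {\<one>\<^bsub>G\<^esub>} \<and>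
    generate G {\<alpha>, \<beta>, \<gamma>} = carrier G \<and>
    latin_bitrade (lcosets\<^bsub>G\<^esub> A) (lcosets\<^bsub>G\<^esub> B) (lcosets\<^bsub>G\<^esub> C) T T' \<and>
    primary_bitrade (lcosets\<^bsub>G\<^esub> A) (lcosets\<^bsub>G\<^esub> B) (lcosets\<^bsub>G\<^esub> C) T T' \<and>
    homogeneous_bitrade (2 * m + 1) (lcosets\<^bsub>G\<^esub> A) (lcosets\<^bsub>G\<^esub> B) (lcosets\<^bsub>G\<^esub> C) T T' \<and>
    card T = fact (3 * m + 1) div 2 \<and> card T' = fact (3 * m + 1) div 2"
proof -
  let ?n = "3 * m + 1"
  let ?as = "[1..<2 * m + 2]"
  define bs cs where "bs = rev [1..<m + 2] @ [2 * m + 2..<3 * m + 2]" and "cs = [m + 1..<3 * m + 2]"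
  interpret group G unfolding assms(2) by (rule alt_group_lr_is_group)
  have as: "cycle ?as" "odd (length ?as)" "set ?as \<subseteq> {1..?n}" and len_as: "length ?as = 2 * m + 1"
    by (auto simp del: upt_Suc)
  have bs: "cycle bs" "odd (length bs)" "set bs \<subseteq> {1..?n}" and len_bs: "length bs = 2 * m + 1"
    by (auto simp: bs_def simp del: upt_Suc)
  have cs: "cycle cs" "odd (length cs)" "set cs \<subseteq> {1..?n}" and len_cs: "length cs = 2 * m + 1"
    by (auto simp: cs_def simp del: upt_Suc)
  have b: "\<beta> = cycle_of_list bs" using assms(4,7) by (simp only: bs_def)
  have a: "\<alpha> = cycle_of_list ?as" using assms(3,6) by (simp only:)
  \<comment> \<open>The product of \<open>a\<close> and \<open>b\<close> in \<open>G\<close> unfolds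
    to \<open>b \<circ> a\<close>, the order used in \<open>two_cycles_product\<close>.\<close>
  have c: "c = cycle_of_list cs"
    using two_cycles_product[OF assms(1)] assms(2-5) by (simp only: cs_def alt_group_lr_simps)
  have \<alpha>: "\<alpha> \<in> carrier G" and \<beta>: "\<beta> \<in> carrier G" and c_carrier: "c \<in> carrier G"
    unfolding a b c assms(2) alt_group_lr_simps
    by (rule cycle_in_alt_group[OF as] cycle_in_alt_group[OF bs] cycle_in_alt_group[OF cs])+
  have \<gamma>: "\<gamma> \<in> carrier G" using c_carrier assms(8) by simp
  have c_eq: "c = \<alpha> \<otimes>\<^bsub>G\<^esub> \<beta>" using assms(5-7) by simp
  have prod: "\<alpha> \<otimes>\<^bsub>G\<^esub> \<beta> \<otimes>\<^bsub>G\<^esub> \<gamma> = \<one>\<^bsub>G\<^esub>"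
    using c_carrier assms(8) by (simp add: c_eq[symmetric])
  have C: "C = generate G {c}"
    using generate_inv_singleton[OF c_carrier] assms(8,11) by simp
  have one: "\<one>\<^bsub>G\<^esub> = id" by (simp add: assms(2))
  \<comment> \<open>The separating points: \<open>2 * m + 1\<close> lies on \<open>a\<close> but not
    on \<open>b\<close>, and 1 lies on \<open>a\<close> and \<open>b\<close> but not on
    \<open>c\<close>.\<close>
  have AB: "A \<inter> B = {\<one>\<^bsub>G\<^esub>}"
    unfolding one unfolding assms(9,10) a b assms(2)
    by (rule generate_cycle_inter_trivial[OF as bs, of "2 * m + 1"]) (use assms(1) in \<open>auto simp: bs_def simp del: upt_Suc\<close>)
  have AC: "A \<inter> C = {\<one>\<^bsub>G\<^esub>}"
    unfolding one unfolding assms(9) C a c assms(2)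
    by (rule generate_cycle_inter_trivial[OF as cs, of 1]) (use assms(1) in \<open>auto simp: cs_def simp del: upt_Suc\<close>)
  have BC: "B \<inter> C = {\<one>\<^bsub>G\<^esub>}"
    unfolding one unfolding assms(10) C b c assms(2)
    by (rule generate_cycle_inter_trivial[OF bs cs, of 1]) (use assms(1) in \<open>auto simp: bs_def cs_def simp del: upt_Suc\<close>)
  have cardA: "card A = 2 * m + 1" and cardB: "card B = 2 * m + 1" and cardC: "card C = 2 * m + 1"
    unfolding assms(9,10) C a b c assms(2)
    using generate_cycle(2)[OF as] generate_cycle(2)[OF bs] generate_cycle(2)[OF cs] len_as len_bs len_cs
    by simp_all
  \<comment> \<open>The identity generates a group of order 1, whereas \<open>A\<close> and
    \<open>B\<close> have order 2m+1 > 1.\<close>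
  have nontrivial: "\<alpha> \<noteq> \<one>\<^bsub>G\<^esub>" "\<beta> \<noteq> \<one>\<^bsub>G\<^esub>"
  proof -
    have "card (generate G {\<one>\<^bsub>G\<^esub>}) = 1" by (simp add: generate_one)
    then show "\<alpha> \<noteq> \<one>\<^bsub>G\<^esub>" "\<beta> \<noteq> \<one>\<^bsub>G\<^esub>" using cardA cardB assms(1,9,10) by auto
  qed
  have gen: "generate G {\<alpha>, \<beta>, \<gamma>} = carrier G"
  proof
    show "generate G {\<alpha>, \<beta>, \<gamma>} \<subseteq> carrier G" using \<alpha> \<beta> \<gamma> by (intro generate_incl) simp
    have "perm_group (generate G {\<alpha>, \<beta>, \<gamma>})"
      using perm_group_generate_alt_group_lr[of "{\<alpha>, \<beta>, \<gamma>}" ?n] \<alpha> \<beta> \<gamma> by (simp add: assms(2))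
    moreover have "\<alpha> \<in> generate G {\<alpha>, \<beta>, \<gamma>}" by (rule generate.incl) simp
    moreover have "c \<in> generate G {\<alpha>, \<beta>, \<gamma>}"
      unfolding c_eq by (intro generate.eng generate.incl) simp_all
    ultimately have "carrier (alt_group ?n) \<subseteq> generate G {\<alpha>, \<beta>, \<gamma>}"
      using assms(1) a c by (intro alt_group_subset_if_two_cycles[of _ m \<alpha> c]) (simp_all only: cs_def)
    then show "carrier G \<subseteq> generate G {\<alpha>, \<beta>, \<gamma>}" by (simp add: assms(2))
  qed
  interpret bitrade_group G A B C \<alpha> \<beta> \<gamma>
  proof (intro bitrade_group.intro bitrade_group_axioms.intro)
    show "finite (carrier G)" by (simp add: assms(2) finite_alt_group)
    show "subgroup A G" "subgroup B G" "subgroup C G"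
      unfolding assms(9-11) using \<alpha> \<beta> \<gamma> by (simp_all add: generate_is_subgroup)
    show "\<alpha> \<in> A" "\<beta> \<in> B" "\<gamma> \<in> C"
      unfolding assms(9-11) by (simp_all add: generate.incl)
  qed (fact is_group prod AB AC BC nontrivial)+
  have T: "T = tri ` carrier G" "T' = tri' ` carrier G"
    unfolding assms(12,13) by (auto simp: tri_def tri'_def)
  \<comment> \<open>On at least two letters the even permutations are half of all;
    \<open>tri\<close> and \<open>tri'\<close> are injective, so this also counts \<open>T\<close>
    and \<open>T'\<close>.\<close>
  have "2 * card (carrier G) = fact ?n"
    using alt_group_card_carrier[of ?n] assms(1) by (simp add: assms(2) del: fact_Suc)
  then have card: "card (carrier G) = fact ?n div 2" by linarith
  show ?thesis
    using \<alpha> \<beta> \<gamma> prod AB AC BC gen latin_bitrade_tri primary_bitrade_tri[OF gen]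
      homogeneous_bitrade_tri[OF cardA cardB cardC] card_image[OF inj_on_tri] card_image[OF inj_on_tri'] card
    unfolding T by (intro conjI) (simp_all only:)
qed

end
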